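(* For every $r>0$, the functional $\mathcal F_r:L^2(I,\mathbb S^2)\to[0,+\infty]$ defined by $$\mathcal F_r(\boldsymbol u)=\begin{cases}\displaystyle |\boldsymbol u_x|_{\mathbb S^2}(I)&\text{if }\boldsymbol u\in BV(I,\mathbb S^2)\text{ and }\boldsymbol u(x)\in\overline{B_{\mathbb S^2}(\boldsymbol e_1,r)}\text{ for a.e. }x\in I,\\ +\infty&\text{otherwise}\end{cases}$$ is not geodesically semiconvex.
   Context: $I\subset\mathbb R$ is a bounded open interval; $\mathbb S^2\subset\mathbb R^3$ is the unit sphere with geodesic distance $\mathrm{dist}_{\mathbb S^2}$; $\boldsymbol e_1=(1,0,0)$; $B_{\mathbb S^2}(\boldsymbol e_1,r)$ is the geodesic ball. $X=L^2(I,\mathbb S^2)$ is equipped with the distance $d(\boldsymbol u,\boldsymbol v)^2=\int_I\mathrm{dist}_{\mathbb S^2}^2(\boldsymbol u(x),\boldsymbol v(x))\,dx$. $BV(I,\mathbb S^2)$ is the set of $\boldsymbol w\in BV(I,\mathbb R^3)$ with values in $\mathbb S^2$ a.e.; for such $\boldsymbol w$, with one-sided limits $\boldsymbol w^\pm$, jump set $J_{\boldsymbol w}$ and $\boldsymbol w_x^d$ the diffuse (non-atomic) part of the derivative measure, $$|\boldsymbol w_x|_{\mathbb S^2}(A)=|\boldsymbol w_x^d|(A)+\sum_{x\in A\cap J_{\boldsymbol w}}\mathrm{dist}_{\mathbb S^2}(\boldsymbol w^-(x),\boldsymbol w^+(x)).$$ In a metric space $(X,d)$, a curve $[0,1]\ni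 t\mapsto\boldsymbol\gamma_t\in X$ is a constant speed geodesic if $d(\boldsymbol\gamma_s,\boldsymbol\gamma_t)=|t-s|\,d(\boldsymbol\gamma_0,\boldsymbol\gamma_1)$ for all $s,t\in[0,1]$. A functional $\mathcal F:X\to\,]-\infty,+\infty]$ is geodesically $\lambda$-convex ($\lambda\in\mathbb R$) if for all $\boldsymbol u,\boldsymbol v\in X$ there is a constant speed geodesic $\boldsymbol\gamma_t$ from $\boldsymbol u$ to $\boldsymbol v$ with $\mathcal F(\boldsymbol\gamma_t)\le(1-t)\mathcal F(\boldsymbol u)+t\mathcal F(\boldsymbol v)-\frac12\lambda t(1-t)d^2(\boldsymbol u,\boldsymbol v)$ for all $t\in[0,1]$. $\mathcal F$ is geodesically semiconvex if it is geodesically $\lambda$-convex for some $\lambda\in\mathbb R$. *)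

theory Defs
  imports "HOL-Analysis.Analysis"
begin

section \<open>Geodesic convexity in metric spaces\<close>

definition const_speed_geodesic ::
    "'a set \<Rightarrow> ('a \<Rightarrow> 'a \<Rightarrow> real) \<Rightarrow> (real \<Rightarrow> 'a) \<Rightarrow> bool" where
  "const_speed_geodesic X d \<gamma> \<longleftrightarrow>
     (\<forall>t\<in>{0..1}. \<gamma> t \<in> X) \<and>
     (\<forall>s\<in>{0..1}. \<forall>t\<in>{0..1}. d (\<gamma> s) (\<gamma> t) = \<bar>t - s\<bar> * d (\<gamma> 0) (\<gamma> 1))"

text \<open>The products are taken in \<^typ>\<open>ereal\<close>, where \<open>0 * \<infinity> = 0\<close>. This matters only for
  \<open>t = 0\<close> and \<open>t = 1\<close>, where the inequality is trivial.\<close>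

definition geodesically_convex ::
    "'a set \<Rightarrow> ('a \<Rightarrow> 'a \<Rightarrow> real) \<Rightarrow> real \<Rightarrow> ('a \<Rightarrow> ereal) \<Rightarrow> bool" where
  "geodesically_convex X d \<kappa> F \<longleftrightarrow>
     (\<forall>u\<in>X. \<forall>v\<in>X. \<exists>\<gamma>. const_speed_geodesic X d \<gamma> \<and> \<gamma> 0 = u \<and> \<gamma> 1 = v \<and>
        (\<forall>t\<in>{0..1}. F (\<gamma> t) \<le> ereal (1 - t) * F u + ereal t * F v
                                 - ereal (1/2 * \<kappa> * t * (1 - t) * (d u v)\<^sup>2)))"

definition geodesically_semiconvex ::
    "'a set \<Rightarrow> ('a \<Rightarrow> 'a \<Rightarrow> real) \<Rightarrow> ('a \<Rightarrow> ereal) \<Rightarrow> bool" where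
  "geodesically_semiconvex X d F \<longleftrightarrow> (\<exists>\<kappa>. geodesically_convex X d \<kappa> F)"


section \<open>The unit sphere\<close>

abbreviation S2 :: "(real^3) set" where
  "S2 \<equiv> sphere 0 1"

definition dist_S2 :: "real^3 \<Rightarrow> real^3 \<Rightarrow> real" where
  "dist_S2 p q = arccos (p \<bullet> q)"

definition ball_S2 :: "real^3 \<Rightarrow> real \<Rightarrow> (real^3) set" where
  "ball_S2 p r = {q \<in> S2. dist_S2 p q < r}"


section \<open>The metric space of square integrable maps into the sphere\<close>

text \<open>Elements are classes of functions modulo equality almost everywhere on \<open>I\<close>.
  Square integrability on a bounded \<open>I\<close> is automatic for maps into the sphere.\<close>

definition ae_eq_rel :: "real set \<Rightarrow> ((real \<Rightarrow> real^3) \<times> (real \<Rightarrow> real^3)) set" where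
  "ae_eq_rel I = {(u, v). AE x in lebesgue_on I. u x = v x}"

definition fun_S2 :: "real set \<Rightarrow> (real \<Rightarrow> real^3) set" where
  "fun_S2 I = {u \<in> borel_measurable (lebesgue_on I). AE x in lebesgue_on I. u x \<in> S2}"

definition L2_S2 :: "real set \<Rightarrow> (real \<Rightarrow> real^3) set set" where
  "L2_S2 I = fun_S2 I // (ae_eq_rel I \<inter> fun_S2 I \<times> fun_S2 I)"

definition rep :: "'a set \<Rightarrow> 'a" where
  "rep U = (SOME u. u \<in> U)"

definition dist_L2 :: "real set \<Rightarrow> (real \<Rightarrow> real^3) set \<Rightarrow> (real \<Rightarrow> real^3) set \<Rightarrow> real" where
  "dist_L2 I U V = sqrt (\<integral>x. (dist_S2 (rep U x) (rep V x))\<^sup>2 \<partial>lebesgue_on I)"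


section \<open>Functions of bounded variation on an interval\<close>

definition test_function :: "real set \<Rightarrow> (real \<Rightarrow> real) \<Rightarrow> bool" where
  "test_function I \<phi> \<longleftrightarrow> \<phi> C1_differentiable_on UNIV \<and>
     compact (closure {x. \<phi> x \<noteq> 0}) \<and> closure {x. \<phi> x \<noteq> 0} \<subseteq> I"

text \<open>Finite vector measures on \<open>I\<close> are set functions \<open>\<mu>\<close>, of which only the values on Borel
  subsets of \<open>I\<close> are relevant. By polar decomposition they are precisely the set functions
  \<open>\<mu> = \<sigma> N\<close> with \<open>N\<close> a finite measure and \<open>\<sigma>\<close> integrable, and then
  \<open>\<integral> \<phi> d\<mu> = \<integral> \<phi> \<sigma> dN\<close>. The predicate below says that \<open>\<mu>\<close> is such a measure and is the
  distributional derivative of \<open>w\<close>; this determines \<open>\<mu>\<close> on the Borel subsets of \<open>I\<close>.\<close>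

definition has_derivative_measure ::
    "real set \<Rightarrow> (real \<Rightarrow> real^3) \<Rightarrow> (real set \<Rightarrow> real^3) \<Rightarrow> bool" where
  "has_derivative_measure I w \<mu> \<longleftrightarrow>
     (\<exists>N \<sigma>. finite_measure N \<and> sets N = sets (restrict_space borel I) \<and> integrable N \<sigma> \<and>
        (\<forall>A\<in>sets N. \<mu> A = (LINT x:A|N. \<sigma> x)) \<and>
        (\<forall>\<phi>. test_function I \<phi> \<longrightarrow>
           (\<integral>x. deriv \<phi> x *\<^sub>R w x \<partial>lebesgue_on I) = - (\<integral>x. \<phi> x *\<^sub>R \<sigma> x \<partial>N)))"

definition BV :: "real set \<Rightarrow> (real \<Rightarrow> real^3) set" where
  "BV I = {w. integrable (lebesgue_on I) w \<and> (\<exists>\<mu>. has_derivative_measure I w \<mu>)}"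

definition BV_S2 :: "real set \<Rightarrow> (real \<Rightarrow> real^3) set" where
  "BV_S2 I = {w \<in> BV I. AE x in lebesgue_on I. w x \<in> S2}"

definition derivative_measure :: "real set \<Rightarrow> (real \<Rightarrow> real^3) \<Rightarrow> real set \<Rightarrow> real^3" where
  "derivative_measure I w = (SOME \<mu>. has_derivative_measure I w \<mu>)"

definition diffuse_part :: "(real set \<Rightarrow> real^3) \<Rightarrow> real set \<Rightarrow> real^3" where
  "diffuse_part \<mu> A = \<mu> (A - {x\<in>A. \<mu> {x} \<noteq> 0})"

definition total_variation :: "(real set \<Rightarrow> real^3) \<Rightarrow> real set \<Rightarrow> ennreal" where
  "total_variation \<mu> A =
     (SUP E \<in> {E :: nat \<Rightarrow> real set. range E \<subseteq> sets borel \<and> disjoint_family E \<and> (\<Union>n. E n) = A}.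
        \<Sum>n. ennreal (norm (\<mu> (E n))))"

text \<open>Essential one-sided limits, i.e. the one-sided limits of a good representative. They are
  insensitive to changes of \<open>w\<close> on null sets, and for \<open>w\<close> in \<^term>\<open>BV I\<close> they exist
  at every point of \<open>I\<close>.\<close>

definition left_lim :: "(real \<Rightarrow> real^3) \<Rightarrow> real \<Rightarrow> real^3" where
  "left_lim w x = Lim (inf (at_left x) (ae_filter lebesgue)) w"

definition right_lim :: "(real \<Rightarrow> real^3) \<Rightarrow> real \<Rightarrow> real^3" where
  "right_lim w x = Lim (inf (at_right x) (ae_filter lebesgue)) w"

definition jump_set :: "real set \<Rightarrow> (real \<Rightarrow> real^3) \<Rightarrow> real set" where
  "jump_set I w = {x\<in>I. left_lim w x \<noteq> right_lim w x}"

definition variation_S2 :: "real set \<Rightarrow> (real \<Rightarrow> real^3) \<Rightarrow> real set \<Rightarrow> ennreal" where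
  "variation_S2 I w A =
     total_variation (diffuse_part (derivative_measure I w)) A +
     (\<Sum>\<^sub>\<infinity>x\<in>A \<inter> jump_set I w. ennreal (dist_S2 (left_lim w x) (right_lim w x)))"


section \<open>The constrained total variation functional\<close>

definition e1 :: "real^3" where
  "e1 = axis 1 1"

definition TV_functional :: "real set \<Rightarrow> real \<Rightarrow> (real \<Rightarrow> real^3) set \<Rightarrow> ereal" where
  "TV_functional I r U =
     (if rep U \<in> BV_S2 I \<and> (AE x in lebesgue_on I. rep U x \<in> closure (ball_S2 e1 r))
      then enn2ereal (variation_S2 I (rep U) I) else \<infinity>)"


section \<open>Independence of the representatives\<close>

abbreviation L2_class :: "real set \<Rightarrow> (real \<Rightarrow> real^3) \<Rightarrow> (real \<Rightarrow> real^3) set" where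
  "L2_class I u \<equiv> (ae_eq_rel I \<inter> fun_S2 I \<times> fun_S2 I) `` {u}"

lemma rep_L2_class:
  assumes "u \<in> fun_S2 I"
  shows "rep (L2_class I u) \<in> fun_S2 I" "AE x in lebesgue_on I. rep (L2_class I u) x = u x"
proof -
  have "u \<in> L2_class I u"
    using assms by (auto simp: ae_eq_rel_def)
  hence "rep (L2_class I u) \<in> L2_class I u"
    unfolding rep_def by (rule someI[where P = "\<lambda>w. w \<in> L2_class I u"])
  thus "rep (L2_class I u) \<in> fun_S2 I" "AE x in lebesgue_on I. rep (L2_class I u) x = u x"
    by (auto simp: ae_eq_rel_def)
qed

lemma borel_measurable_arccos: "arccos \<in> borel_measurable borel"
proof -
  have eq: "arccos x = (if x \<in> {-1..1} then arccos x else arccos 2)" for x :: real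
  proof (cases "x \<in> {-1..1}")
    case False
    have *: "cos t \<noteq> y" if "y \<notin> {-1..1}" for t y :: real
      using that cos_ge_minus_one[of t] cos_le_one[of t] by auto
    have "cos t \<noteq> x" "cos t \<noteq> 2" for t
      using False *[of x t] *[of 2 t] by auto
    with False show ?thesis
      by (simp add: arccos_def)
  qed simp
  have "(\<lambda>x. if x \<in> {-1..1} then arccos x else arccos 2) \<in> borel_measurable borel"
    by (intro borel_measurable_continuous_on_if continuous_on_arccos' continuous_on_const) auto
  thus ?thesis
    by (rule ssubst[OF ext[OF eq]])
qed

lemma dist_L2_class:
  assumes u: "u \<in> fun_S2 I" and v: "v \<in> fun_S2 I"
  shows "dist_L2 I (L2_class I u) (L2_class I v) =
           sqrt (\<integral>x. (dist_S2 (u x) (v x))\<^sup>2 \<partial>lebesgue_on I)"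
proof -
  have meas: "(\<lambda>x. (dist_S2 (f x) (g x))\<^sup>2) \<in> borel_measurable (lebesgue_on I)"
    if "f \<in> fun_S2 I" "g \<in> fun_S2 I" for f g
    using that unfolding fun_S2_def dist_S2_def
    by (auto intro!: borel_measurable_power measurable_compose[OF _ borel_measurable_arccos])
  have "AE x in lebesgue_on I. (dist_S2 (rep (L2_class I u) x) (rep (L2_class I v) x))\<^sup>2 =
                               (dist_S2 (u x) (v x))\<^sup>2"
    using rep_L2_class(2)[OF u] rep_L2_class(2)[OF v] by eventually_elim simp
  thus ?thesis
    unfolding dist_L2_def
    by (intro arg_cong[where f = sqrt] integral_cong_AE meas rep_L2_class(1) u v)
qed

lemma has_derivative_measure_cong_AE:
  assumes "u \<in> borel_measurable (lebesgue_on I)" "v \<in> borel_measurable (lebesgue_on I)"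
    and eq: "AE x in lebesgue_on I. u x = v x"
  shows "has_derivative_measure I u = has_derivative_measure I v"
proof -
  have "(\<integral>x. deriv \<phi> x *\<^sub>R u x \<partial>lebesgue_on I) = (\<integral>x. deriv \<phi> x *\<^sub>R v x \<partial>lebesgue_on I)"
    if \<phi>: "test_function I \<phi>" for \<phi>
  proof -
    obtain D where "\<forall>x. (\<phi> has_vector_derivative D x) (at x)" and D: "continuous_on UNIV D"
      using \<phi> by (auto simp: test_function_def C1_differentiable_on_def)
    hence "deriv \<phi> = D"
      by (auto intro!: DERIV_imp_deriv simp: has_real_derivative_iff_has_vector_derivative)
    with D have "deriv \<phi> \<in> borel_measurable borel"
      by (simp add: borel_measurable_continuous_onI)
    hence "deriv \<phi> \<in> borel_measurable lebesgue"
      by (intro measurable_completion) simp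
    hence "deriv \<phi> \<in> borel_measurable (lebesgue_on I)"
      by (rule measurable_restrict_space1)
    with assms show ?thesis
      by (intro integral_cong_AE) auto
  qed
  thus ?thesis
    unfolding has_derivative_measure_def fun_eq_iff by auto
qed

lemma one_sided_lims_cong_AE:
  assumes "open I" "x \<in> I" and eq: "AE y in lebesgue_on I. u y = v y"
  shows "left_lim u x = left_lim v x" "right_lim u x = right_lim v x"
proof -
  have I: "I \<in> sets lebesgue"
    using \<open>open I\<close> by (metis borel_open sets_completionI_sets sets_lborel)
  have "AE y in lebesgue. y \<in> I \<longrightarrow> u y = v y"
    using eq I by (subst (asm) AE_restrict_space_iff) auto
  hence A: "\<forall>\<^sub>F y in inf F (ae_filter lebesgue). u y = v y" if "\<forall>\<^sub>F y in F. y \<in> I" for F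
    using that unfolding eventually_inf by blast
  have "\<forall>\<^sub>F y in at_left x. y \<in> I" "\<forall>\<^sub>F y in at_right x. y \<in> I"
    using assms by (meson eventually_at_topological)+
  note ev = this[THEN A]
  show "left_lim u x = left_lim v x" "right_lim u x = right_lim v x"
    unfolding left_lim_def right_lim_def Topological_Spaces.Lim_def
      tendsto_cong[OF ev(1)] tendsto_cong[OF ev(2)] by rule+
qed

lemma variation_S2_cong_AE:
  assumes "open I" "A \<subseteq> I"
    and "u \<in> borel_measurable (lebesgue_on I)" "v \<in> borel_measurable (lebesgue_on I)"
    and "AE x in lebesgue_on I. u x = v x"
  shows "variation_S2 I u A = variation_S2 I v A"
proof -
  note lims = one_sided_lims_cong_AE[OF \<open>open I\<close> _ assms(5)]
  have J: "jump_set I u = jump_set I v"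
    unfolding jump_set_def using lims by auto
  have "(\<Sum>\<^sub>\<infinity>x\<in>A \<inter> jump_set I u. ennreal (dist_S2 (left_lim u x) (right_lim u x))) =
        (\<Sum>\<^sub>\<infinity>x\<in>A \<inter> jump_set I v. ennreal (dist_S2 (left_lim v x) (right_lim v x)))"
    unfolding J by (rule infsum_cong) (use lims assms(2) in auto)
  thus ?thesis
    unfolding variation_S2_def derivative_measure_def
      has_derivative_measure_cong_AE[OF assms(3-5)] by simp
qed

lemma TV_functional_class:
  assumes "open I" and u: "u \<in> fun_S2 I"
  shows "TV_functional I r (L2_class I u) =
     (if u \<in> BV_S2 I \<and> (AE x in lebesgue_on I. u x \<in> closure (ball_S2 e1 r))
      then enn2ereal (variation_S2 I u I) else \<infinity>)"
proof -
  define w where "w = rep (L2_class I u)"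
  have w: "w \<in> fun_S2 I" and eq: "AE x in lebesgue_on I. w x = u x"
    unfolding w_def using rep_L2_class[OF u] by auto
  have meas: "w \<in> borel_measurable (lebesgue_on I)" "u \<in> borel_measurable (lebesgue_on I)"
    using u w by (auto simp: fun_S2_def)
  have AE_iff: "(AE x in lebesgue_on I. w x \<in> B) \<longleftrightarrow> (AE x in lebesgue_on I. u x \<in> B)" for B
    using eq by (intro iffI; elim AE_mp) auto
  have "w \<in> BV_S2 I \<longleftrightarrow> u \<in> BV_S2 I"
    unfolding BV_S2_def BV_def mem_Collect_eq has_derivative_measure_cong_AE[OF meas eq]
      AE_iff integrable_cong_AE[OF meas eq] by (rule refl)
  thus ?thesis
    unfolding TV_functional_def w_def[symmetric] AE_iff
    using variation_S2_cong_AE[OF \<open>open I\<close> order.refl meas eq] by simp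
qed

end

theory Submission
  imports Defs
begin

text \<open>
  On a positively curved surface the distance between two geodesics need not be convex. For two
  points \<open>p\<close>, \<open>q\<close> of the same small northern latitude and their mirror images \<open>p'\<close>, \<open>q'\<close> below the
  equator, the midpoints \<open>m\<close>, \<open>m'\<close> of the meridian arcs from \<open>p\<close> to \<open>p'\<close> and from \<open>q\<close> to \<open>q'\<close> are
  further apart than \<open>p\<close> from \<open>q\<close> or \<open>p'\<close> from \<open>q'\<close> (\<open>spherical_rectangle\<close>). All points can be
  taken as close to \<open>e1\<close> as desired.

  Let \<open>u\<close> be a step function on the interval that jumps \<open>n\<close> times back and forth between \<open>p\<close> and
  \<open>q\<close>, and let \<open>v\<close> jump between \<open>p'\<close> and \<open>q'\<close> at the same places. Since \<open>p\<close>, \<open>p'\<close> and \<open>q\<close>, \<open>q'\<close>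
  are not antipodal, the midpoint of any geodesic from \<open>u\<close> to \<open>v\<close> is forced to be the step function
  jumping between \<open>m\<close> and \<open>m'\<close> (\<open>L2_midpoint_pointwise\<close>, \<open>S2_midpoint_unique\<close>). The variation of
  the three step functions is \<open>n\<close> times the respective distance (\<open>variation_S2_oscillation\<close>), so
  convexity at time \<open>1/2\<close> is violated by a fixed positive multiple of \<open>n\<close>. The distance between
  \<open>u\<close> and \<open>v\<close>, and with it the correction allowed by semiconvexity, does not depend on \<open>n\<close>.
  Letting \<open>n\<close> grow rules out every \<open>\<kappa>\<close>.

  The variation is defined through an unspecified derivative measure, so its value on a step
  function rests on the fact that test functions determine the derivative measure
  (\<open>has_derivative_measure_unique\<close>).
\<close>

section \<open>Geometry of the sphere\<close>

lemma dist_S2_bounds: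
  assumes "p \<in> S2" "q \<in> S2"
  shows "\<bar>p \<bullet> q\<bar> \<le> 1" "0 \<le> dist_S2 p q" "dist_S2 p q \<le> pi" "cos (dist_S2 p q) = p \<bullet> q"
proof -
  show 1: "\<bar>p \<bullet> q\<bar> \<le> 1"
    using Cauchy_Schwarz_ineq2[of p q] assms by simp
  thus "0 \<le> dist_S2 p q" "dist_S2 p q \<le> pi" "cos (dist_S2 p q) = p \<bullet> q"
    by (auto simp: dist_S2_def abs_le_iff intro!: arccos_lbound arccos_ubound cos_arccos)
qed

lemma dist_S2_self: "p \<in> S2 \<Longrightarrow> dist_S2 p p = 0"
  by (simp add: dist_S2_def dot_square_norm)

lemma dist_S2_commute: "dist_S2 p q = dist_S2 q p"
  by (simp add: dist_S2_def inner_commute)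

text \<open>The components of \<open>p\<close> and \<open>q\<close> orthogonal to \<open>w\<close> have lengths \<open>sin f\<close> and \<open>sin g\<close>, where
  \<open>f\<close>, \<open>g\<close> are the distances to \<open>w\<close>. By Cauchy--Schwarz for these components, \<open>p \<bullet> q\<close> is at
  least \<open>cos f cos g - sin f sin g = cos (f + g)\<close>.\<close>
lemma dist_S2_triangle:
  assumes p: "p \<in> S2" and w: "w \<in> S2" and q: "q \<in> S2"
  shows "dist_S2 p q \<le> dist_S2 p w + dist_S2 w q"
proof (cases "dist_S2 p w + dist_S2 w q \<le> pi")
  case False
  thus ?thesis using dist_S2_bounds(3)[OF p q] by simp
next
  case True
  define f g where "f = dist_S2 p w" and "g = dist_S2 w q"
  note F = dist_S2_bounds[OF p w, folded f_def] and G = dist_S2_bounds[OF w q, folded g_def]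
  have one: "p \<bullet> p = 1" "w \<bullet> w = 1" "q \<bullet> q = 1"
    using p w q by (simp_all add: dot_square_norm)
  have norm_p: "norm (p - (p \<bullet> w) *\<^sub>R w) = sin f"
  proof -
    have "(norm (p - (p \<bullet> w) *\<^sub>R w))\<^sup>2 = 1 - (p \<bullet> w)\<^sup>2"
      unfolding power2_norm_eq_inner by (simp add: inner_simps one inner_commute power2_eq_square)
    also have "\<dots> = (sin f)\<^sup>2"
      by (simp add: sin_squared_eq F(4))
    finally show ?thesis
      using sin_ge_zero[OF F(2,3)] by (simp add: power2_eq_iff_nonneg)
  qed
  have norm_q: "norm (q - (w \<bullet> q) *\<^sub>R w) = sin g"
  proof -
    have "(norm (q - (w \<bullet> q) *\<^sub>R w))\<^sup>2 = 1 - (w \<bullet> q)\<^sup>2"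
      unfolding power2_norm_eq_inner by (simp add: inner_simps one inner_commute power2_eq_square)
    also have "\<dots> = (sin g)\<^sup>2"
      by (simp add: sin_squared_eq G(4))
    finally show ?thesis
      using sin_ge_zero[OF G(2,3)] by (simp add: power2_eq_iff_nonneg)
  qed
  have "cos f * cos g - p \<bullet> q = - ((p - (p \<bullet> w) *\<^sub>R w) \<bullet> (q - (w \<bullet> q) *\<^sub>R w))"
    by (simp add: inner_simps one F(4) G(4) inner_commute)
  also have "\<dots> \<le> sin f * sin g"
    using Cauchy_Schwarz_ineq2[of "p - (p \<bullet> w) *\<^sub>R w" "q - (w \<bullet> q) *\<^sub>R w"] norm_p norm_q
    by simp
  finally have "cos (f + g) \<le> p \<bullet> q"
    by (simp add: cos_add)
  hence "arccos (p \<bullet> q) \<le> arccos (cos (f + g))"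
    using dist_S2_bounds(1)[OF p q] by (subst arccos_le_mono) auto
  also have "\<dots> = f + g"
    using True F(2) G(2) by (intro arccos_cos) (auto simp: f_def g_def)
  finally show ?thesis
    by (simp add: dist_S2_def f_def g_def)
qed

text \<open>Both distance conditions are linear in \<open>w\<close> once the cosine is taken. Adding them gives
  \<open>m \<bullet> w = 1\<close>, the equality case of Cauchy--Schwarz. The condition on \<open>cos \<delta>\<close> excludes
  antipodal \<open>p\<close> and \<open>q\<close>, which have a whole circle of midpoints.\<close>
lemma S2_midpoint_unique:
  assumes S: "p \<in> S2" "q \<in> S2" "m \<in> S2" "w \<in> S2"
    and m: "p + q = (2 * cos \<delta>) *\<^sub>R m" and "cos \<delta> \<noteq> 0"
    and w: "dist_S2 p w = \<delta>" "dist_S2 w q = \<delta>"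
  shows "w = m"
proof -
  have "p \<bullet> w = cos \<delta>" "w \<bullet> q = cos \<delta>"
    using dist_S2_bounds(4)[of p w] dist_S2_bounds(4)[of w q] S w by auto
  hence "(p + q) \<bullet> w = 2 * cos \<delta>"
    by (metis inner_add_left inner_commute mult_2)
  hence "m \<bullet> w = 1"
    using \<open>cos \<delta> \<noteq> 0\<close> by (simp add: m)
  hence "(w - m) \<bullet> (w - m) = 0"
    using S unfolding inner_diff_left inner_diff_right by (simp add: inner_commute dot_square_norm)
  thus ?thesis by simp
qed

text \<open>The failure of convexity of the distance between two geodesics of the sphere. The points
  \<open>p\<close>, \<open>q\<close> have latitude \<open>\<phi>\<close> and longitudes \<open>\<phi>\<close>, \<open>-\<phi>\<close>, and \<open>p'\<close>, \<open>q'\<close> are their mirror images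
  below the equator. The meridian arcs from \<open>p\<close> to \<open>p'\<close> and from \<open>q\<close> to \<open>q'\<close> meet the equator at their
  midpoints \<open>m\<close>, \<open>m'\<close>, and meridians are furthest apart at the equator. The route from \<open>e1\<close> via \<open>m\<close> or
  \<open>m'\<close> to a vertex bounds the distance of the vertices from \<open>e1\<close>.\<close>
lemma spherical_rectangle:
  assumes "0 < \<phi>" "\<phi> < pi / 4"
  obtains p p' q q' m m' :: "real^3"
  where "{p, p', q, q', m, m'} \<subseteq> S2"
    and "\<And>x. x \<in> {p, p', q, q'} \<Longrightarrow> dist_S2 e1 x \<le> 2 * \<phi>"
    and "p + p' = (2 * cos \<phi>) *\<^sub>R m" "q + q' = (2 * cos \<phi>) *\<^sub>R m'"
    and "dist_S2 p p' = 2 * \<phi>" "dist_S2 q q' = 2 * \<phi>"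
    and "dist_S2 p q < dist_S2 m m'" "dist_S2 p' q' < dist_S2 m m'"
proof
  define s c where "s = sin \<phi>" and "c = cos \<phi>"
  have sc: "s * s + c * c = 1"
    using sin_cos_squared_add[of \<phi>] by (simp add: s_def c_def power2_eq_square)
  have s: "0 < s"
    using assms by (auto simp: s_def intro!: sin_gt_zero)
  have cos2: "c * c - s * s = cos (2 * \<phi>)"
    by (simp add: c_def s_def cos_double power2_eq_square)
  let ?pt = "\<lambda>\<epsilon> \<delta>. vector [c * c, \<epsilon> * (c * s), \<delta> * s] :: real^3"
  let ?m = "\<lambda>\<epsilon>. vector [c, \<epsilon> * s, 0] :: real^3"
  note inner = inner_vec_def sum_3
  have sphere: "x \<in> S2" if "x \<bullet> x = 1" for x :: "real^3"
    using that by (simp add: norm_eq_1)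
  have cs4: "c * c * (c * c) + c * s * (c * s) + s * s = 1"
    using sc by algebra
  have pt: "?pt \<epsilon> \<delta> \<in> S2" if "\<epsilon> * \<epsilon> = 1" "\<delta> * \<delta> = 1" for \<epsilon> \<delta>
    using that cs4 by (intro sphere) (simp add: inner, algebra)
  have m: "?m \<epsilon> \<in> S2" if "\<epsilon> * \<epsilon> = 1" for \<epsilon>
    using that sc by (intro sphere) (simp add: inner, algebra)
  have e1: "e1 \<in> S2"
    by (simp add: e1_def)
  have half: "arccos c = \<phi>" "arccos (cos (2 * \<phi>)) = 2 * \<phi>"
    using assms unfolding c_def by (auto intro!: arccos_cos)
  show "{?pt 1 1, ?pt 1 (-1), ?pt (-1) 1, ?pt (-1) (-1), ?m 1, ?m (-1)} \<subseteq> S2"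
    using pt[of 1 1] pt[of 1 "-1"] pt[of "-1" 1] pt[of "-1" "-1"] m[of 1] m[of "-1"] by simp
  have "dist_S2 e1 (?pt \<epsilon> \<delta>) \<le> 2 * \<phi>" if "\<epsilon> * \<epsilon> = 1" "\<delta> * \<delta> = 1" for \<epsilon> \<delta>
  proof -
    have "e1 \<bullet> ?m \<epsilon> = c"
      by (simp add: e1_def inner axis_def)
    moreover have "?m \<epsilon> \<bullet> ?pt \<epsilon> \<delta> = c"
      using that sc by (simp add: inner, algebra)
    ultimately have "dist_S2 e1 (?m \<epsilon>) = \<phi>" "dist_S2 (?m \<epsilon>) (?pt \<epsilon> \<delta>) = \<phi>"
      by (simp_all add: dist_S2_def half)
    thus ?thesis
      using dist_S2_triangle[OF e1 m[OF that(1)] pt[OF that]] by simp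
  qed
  from this[of 1 1] this[of 1 "-1"] this[of "-1" 1] this[of "-1" "-1"]
  show "dist_S2 e1 x \<le> 2 * \<phi>"
    if "x \<in> {?pt 1 1, ?pt 1 (-1), ?pt (-1) 1, ?pt (-1) (-1)}" for x
    using that by auto
  show "?pt 1 1 + ?pt 1 (-1) = (2 * cos \<phi>) *\<^sub>R ?m 1" "?pt (-1) 1 + ?pt (-1) (-1) = (2 * cos \<phi>) *\<^sub>R ?m (-1)"
    by (simp_all add: vec_eq_iff forall_3 c_def)
  have "?pt \<epsilon> 1 \<bullet> ?pt \<epsilon> (-1) = c * c - s * s" if "\<epsilon> * \<epsilon> = 1" for \<epsilon>
    using that sc by (simp add: inner, algebra)
  from this[of 1] this[of "-1"]
  show "dist_S2 (?pt 1 1) (?pt 1 (-1)) = 2 * \<phi>" "dist_S2 (?pt (-1) 1) (?pt (-1) (-1)) = 2 * \<phi>"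
    by (simp_all add: dist_S2_def cos2 half)
  have lt: "dist_S2 (?pt 1 \<delta>) (?pt (-1) \<delta>) < dist_S2 (?m 1) (?m (-1))" if "\<delta> * \<delta> = 1" for \<delta>
  proof -
    have cc: "c * c = 1 - s * s"
      using sc by simp
    have "?pt 1 \<delta> \<bullet> ?pt (-1) \<delta> - ?m 1 \<bullet> ?m (-1) =
        (c * c) * (c * c) - (c * c) * (s * s) + (\<delta> * \<delta>) * (s * s) - c * c + s * s"
      by (simp add: inner algebra_simps)
    also have "\<dots> = 2 * (s * s) * (s * s)"
      unfolding that cc by (simp add: algebra_simps)
    also have "\<dots> > 0"
      using s by simp
    finally show ?thesis
      unfolding dist_S2_def
      by (subst arccos_less_mono) (auto simp only: that intro!: dist_S2_bounds(1) pt m)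
  qed
  from lt[of 1] lt[of "-1"]
  show "dist_S2 (?pt 1 1) (?pt (-1) 1) < dist_S2 (?m 1) (?m (-1))"
       "dist_S2 (?pt 1 (-1)) (?pt (-1) (-1)) < dist_S2 (?m 1) (?m (-1))"
    by simp_all
qed

section \<open>Geodesics in the space of maps into the sphere\<close>

lemma integrable_dist_S2_sq:
  assumes "finite_measure (lebesgue_on I)" and u: "u \<in> fun_S2 I" and v: "v \<in> fun_S2 I"
  shows "integrable (lebesgue_on I) (\<lambda>x. (dist_S2 (u x) (v x))\<^sup>2)"
proof (rule finite_measure.integrable_const_bound[OF assms(1), where B = "pi\<^sup>2"])
  show "AE x in lebesgue_on I. norm ((dist_S2 (u x) (v x))\<^sup>2) \<le> pi\<^sup>2"
  proof -
    have "AE x in lebesgue_on I. u x \<in> S2" "AE x in lebesgue_on I. v x \<in> S2"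
      using u v by (auto simp: fun_S2_def)
    thus ?thesis
      by eventually_elim (use dist_S2_bounds in \<open>auto intro!: power_mono\<close>)
  qed
  show "(\<lambda>x. (dist_S2 (u x) (v x))\<^sup>2) \<in> borel_measurable (lebesgue_on I)"
    using u v unfolding fun_S2_def dist_S2_def
    by (auto intro!: borel_measurable_power measurable_compose[OF _ borel_measurable_arccos])
qed

text \<open>A midpoint in the space of maps is a midpoint at almost every point. With \<open>e\<close>, \<open>f\<close>, \<open>g\<close> the
  pointwise distances between \<open>u\<close> and \<open>v\<close>, \<open>u\<close> and \<open>w\<close>, \<open>w\<close> and \<open>v\<close>, the function
  \<open>f\<^sup>2 + g\<^sup>2 - e\<^sup>2/2\<close> is nonnegative by the triangle inequality, and the hypotheses say that its
  integral vanishes. So it vanishes almost everywhere, which forces \<open>f = g = e/2\<close>.\<close>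
lemma L2_midpoint_pointwise:
  assumes fin: "finite_measure (lebesgue_on I)"
    and u: "u \<in> fun_S2 I" and v: "v \<in> fun_S2 I" and w: "w \<in> fun_S2 I"
    and uw: "dist_L2 I (L2_class I u) (L2_class I w) = dist_L2 I (L2_class I u) (L2_class I v) / 2"
    and wv: "dist_L2 I (L2_class I w) (L2_class I v) = dist_L2 I (L2_class I u) (L2_class I v) / 2"
  shows "AE x in lebesgue_on I. dist_S2 (u x) (w x) = dist_S2 (u x) (v x) / 2 \<and>
                                dist_S2 (w x) (v x) = dist_S2 (u x) (v x) / 2"
proof -
  define h where "h x = (dist_S2 (u x) (w x))\<^sup>2 + (dist_S2 (w x) (v x))\<^sup>2
                        - (dist_S2 (u x) (v x))\<^sup>2 / 2" for x
  note int = integrable_dist_S2_sq[OF fin]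
  have h_int: "integrable (lebesgue_on I) h"
    unfolding h_def using int u v w by simp
  have S: "AE x in lebesgue_on I. u x \<in> S2 \<and> v x \<in> S2 \<and> w x \<in> S2"
    using u v w by (auto simp: fun_S2_def)
  \<comment> \<open>The identity
    \<open>f\<^sup>2 + g\<^sup>2 - e\<^sup>2/2 = (f - g)\<^sup>2/2 + ((f + g)\<^sup>2 - e\<^sup>2)/2\<close>, whose last term is
    nonnegative by the triangle inequality \<open>e \<le> f + g\<close>.\<close>
  have split: "(dist_S2 (u x) (w x) - dist_S2 (w x) (v x))\<^sup>2 / 2 \<le> h x"
    if "u x \<in> S2 \<and> v x \<in> S2 \<and> w x \<in> S2" for x
  proof -
    have "(dist_S2 (u x) (v x))\<^sup>2 \<le> (dist_S2 (u x) (w x) + dist_S2 (w x) (v x))\<^sup>2"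
      using that by (intro power_mono dist_S2_triangle dist_S2_bounds) auto
    thus ?thesis
      by (simp add: h_def power2_eq_square field_simps)
  qed
  have nonneg: "AE x in lebesgue_on I. 0 \<le> h x"
    using S by eventually_elim (rule order.trans[OF _ split], simp_all)
  have sq: "(\<integral>x. (dist_S2 (f x) (g x))\<^sup>2 \<partial>lebesgue_on I) = (dist_L2 I (L2_class I f) (L2_class I g))\<^sup>2"
    if "f \<in> fun_S2 I" "g \<in> fun_S2 I" for f g
    unfolding dist_L2_class[OF that] by simp
  have "integral\<^sup>L (lebesgue_on I) h = 0"
    unfolding h_def using int u v w
    by (simp add: sq uw wv power_divide)
  hence "AE x in lebesgue_on I. h x = 0"
    using integral_nonneg_eq_0_iff_AE[OF h_int nonneg] by simp
  with S show ?thesis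
  proof eventually_elim
    case (elim x)
    with split[of x] have eq: "dist_S2 (u x) (w x) = dist_S2 (w x) (v x)"
      by (simp add: power2_less_eq_zero_iff)
    with elim have "(2 * dist_S2 (u x) (w x))\<^sup>2 = (dist_S2 (u x) (v x))\<^sup>2"
      by (simp add: h_def power_mult_distrib)
    hence "2 * dist_S2 (u x) (w x) = dist_S2 (u x) (v x)"
      using elim dist_S2_bounds(2) by (subst (asm) power2_eq_iff_nonneg) auto
    with eq show ?case by simp
  qed
qed

section \<open>Uniqueness of the derivative measure\<close>

text \<open>Test functions supported in \<open>{c + 1/(n+1)..d - 1/(n+1)}\<close>, with values between 0 and 1, that
  converge pointwise to the indicator of \<open>{c<..<d}\<close>: the function \<open>1 - 1 / (1 + n g)\<close> tends to 1
  where \<open>g\<close> stays away from 0. Shrinking the support makes it compact in \<open>{c<..<d}\<close>, so that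
  intervals reaching up to the end points of the domain are admissible.\<close>
definition plateau :: "real \<Rightarrow> real \<Rightarrow> nat \<Rightarrow> real \<Rightarrow> real" where
  "plateau c d n x =
     (let e = 1 / real (Suc n); g = (max 0 (x - (c + e)))\<^sup>2 * (max 0 ((d - e) - x))\<^sup>2
      in 1 - 1 / (1 + real n * g))"

lemma DERIV_max_0_square: "((\<lambda>x::real. (max 0 x)\<^sup>2) has_real_derivative 2 * max 0 x) (at x)"
proof -
  consider "x < 0" | "x = 0" | "x > 0" by linarith
  thus ?thesis
  proof cases
    case 1
    have "((\<lambda>x::real. 0) has_real_derivative 0) (at x)" by simp
    hence "((\<lambda>x::real. (max 0 x)\<^sup>2) has_real_derivative 0) (at x)"
      by (rule DERIV_cong_ev[THEN iffD1, rotated 3])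
         (use 1 eventually_nhds_in_open[of "{..<0}" x] in \<open>auto elim!: eventually_mono\<close>)
    thus ?thesis using 1 by simp
  next
    case 3
    have "((\<lambda>x::real. x\<^sup>2) has_real_derivative 2 * x) (at x)"
      by (auto intro!: derivative_eq_intros)
    hence "((\<lambda>x::real. (max 0 x)\<^sup>2) has_real_derivative 2 * x) (at x)"
      by (rule DERIV_cong_ev[THEN iffD1, rotated 3])
         (use 3 eventually_nhds_in_open[of "{0<..}" x] in \<open>auto elim!: eventually_mono\<close>)
    thus ?thesis using 3 by simp
  next
    case 2
    have "((\<lambda>h::real. max 0 h) \<longlongrightarrow> 0) (at 0)"
      using tendsto_max[OF tendsto_const[of "0::real"] tendsto_ident_at[of 0 UNIV]] by simp
    hence "((\<lambda>h::real. (max 0 h)\<^sup>2 / h) \<longlongrightarrow> 0) (at 0)"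
      by (rule Lim_transform_eventually)
         (auto simp: eventually_at_filter max_def power2_eq_square)
    thus ?thesis using 2 by (simp add: DERIV_def)
  qed
qed

lemma plateau_bounds: "0 \<le> plateau c d n x" "plateau c d n x \<le> 1"
  by (simp_all add: plateau_def Let_def add_pos_nonneg del: of_nat_Suc)

lemma plateau_eq_0: "x \<notin> {c + 1 / real (Suc n)..d - 1 / real (Suc n)} \<Longrightarrow> plateau c d n x = 0"
  by (auto simp: plateau_def Let_def max_def)

lemma test_function_plateau:
  assumes "{c<..<d} \<subseteq> I"
  shows "test_function I (plateau c d n)"
proof -
  define e where "e = 1 / real (Suc n)"
  have e: "e > 0" by (simp add: e_def)
  let ?l = "\<lambda>x. max 0 (x - (c + e))" and ?r = "\<lambda>x. max 0 ((d - e) - x)"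
  let ?g = "\<lambda>x. (?l x)\<^sup>2 * (?r x)\<^sup>2"
  let ?g' = "\<lambda>x. 2 * ?l x * (?r x)\<^sup>2 - (?l x)\<^sup>2 * (2 * ?r x)"
  have "((\<lambda>x. x - (c + e)) has_real_derivative 1) (at x)"
       "((\<lambda>x. (d - e) - x) has_real_derivative - 1) (at x)" for x
    by (auto intro!: derivative_eq_intros)
  note lr = this[THEN DERIV_chain2[where f = "\<lambda>x. (max 0 x)\<^sup>2", OF DERIV_max_0_square]]
  have g: "(?g has_real_derivative ?g' x) (at x)" for x
    by (rule DERIV_cong[OF DERIV_mult[OF lr]]) (simp add: algebra_simps)
  have pos: "1 + real n * ?g x > 0" for x
    by (simp add: add_pos_nonneg)
  have p: "plateau c d n = (\<lambda>x. 1 - 1 / (1 + real n * ?g x))"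
    by (simp add: plateau_def Let_def e_def fun_eq_iff del: of_nat_Suc)
  have "(plateau c d n has_real_derivative real n * ?g' x / (1 + real n * ?g x)\<^sup>2) (at x)" for x
    unfolding p
    by (rule derivative_eq_intros g refl)+
       (use pos[of x] in \<open>auto simp: power2_eq_square\<close>)
  moreover have "continuous_on UNIV (\<lambda>x. real n * ?g' x / (1 + real n * ?g x)\<^sup>2)"
    by (intro continuous_intros) (use pos in \<open>auto simp: less_imp_neq[symmetric]\<close>)
  ultimately have C1: "plateau c d n C1_differentiable_on UNIV"
    unfolding C1_differentiable_on_def has_real_derivative_iff_has_vector_derivative
    by (intro exI conjI ballI)
  have "{x. plateau c d n x \<noteq> 0} \<subseteq> {c + e..d - e}"
    using plateau_eq_0 unfolding e_def by blast
  hence sub: "closure {x. plateau c d n x \<noteq> 0} \<subseteq> {c + e..d - e}"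
    by (intro closure_minimal) auto
  moreover have "{c + e..d - e} \<subseteq> I"
    using e assms by auto
  moreover have "compact (closure {x. plateau c d n x \<noteq> 0})"
    using sub by (meson bounded_closed_interval bounded_subset closed_closure compact_eq_bounded_closed)
  ultimately show ?thesis
    using C1 unfolding test_function_def by blast
qed

lemma plateau_tendsto_indicator: "(\<lambda>n. plateau c d n x) \<longlonglongrightarrow> indicator {c<..<d} x"
proof (cases "x \<in> {c<..<d}")
  case False
  have "plateau c d n x = 0" for n
  proof (rule plateau_eq_0)
    have "0 < 1 / real (Suc n)" by simp
    thus "x \<notin> {c + 1 / real (Suc n)..d - 1 / real (Suc n)}"
      using False unfolding greaterThanLessThan_iff atLeastAtMost_iff by linarith
  qed
  thus ?thesis using False by simp
next
  case True
  let ?g = "\<lambda>n. (max 0 (x - (c + 1 / real (Suc n))))\<^sup>2 * (max 0 ((d - 1 / real (Suc n)) - x))\<^sup>2"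
  have "?g \<longlonglongrightarrow> (max 0 (x - (c + 0)))\<^sup>2 * (max 0 ((d - 0) - x))\<^sup>2"
    by (intro tendsto_intros LIMSEQ_Suc lim_1_over_n)
  moreover have "0 < (max 0 (x - (c + 0)))\<^sup>2 * (max 0 ((d - 0) - x))\<^sup>2"
    using True by auto
  ultimately have "LIM n sequentially. ?g n * real n :> at_top"
    using filterlim_real_sequentially by (rule filterlim_tendsto_pos_mult_at_top)
  hence "LIM n sequentially. 1 + ?g n * real n :> at_top"
    by (rule filterlim_tendsto_add_at_top[OF tendsto_const])
  hence "(\<lambda>n. 1 - 1 / (1 + ?g n * real n)) \<longlonglongrightarrow> 1 - 0"
    by (intro tendsto_diff tendsto_const tendsto_divide_0[OF tendsto_const] filterlim_at_top_imp_at_infinity)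
  moreover have "plateau c d n x = 1 - 1 / (1 + ?g n * real n)" for n
    by (simp add: plateau_def Let_def mult.commute)
  ultimately show ?thesis using True by simp
qed

lemma plateau_integral_tendsto:
  fixes \<sigma> :: "real \<Rightarrow> 'b :: {banach, second_countable_topology}"
  assumes "integrable N \<sigma>" and N: "sets N = sets (restrict_space borel I)"
  shows "(\<lambda>n. \<integral>x. plateau c d n x *\<^sub>R \<sigma> x \<partial>N) \<longlonglongrightarrow> (LINT x:{c<..<d}|N. \<sigma> x)"
  unfolding set_lebesgue_integral_def
proof (rule integral_dominated_convergence[where w = "\<lambda>x. norm (\<sigma> x)"])
  have meas: "f \<in> borel_measurable N" if "f \<in> borel_measurable borel" for f :: "real \<Rightarrow> real"
    using measurable_restrict_space1[OF that] measurable_cong_sets[OF N refl] by blast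
  have "plateau c d n \<in> borel_measurable borel" for n
    unfolding plateau_def Let_def by measurable
  thus "(\<lambda>x. plateau c d n x *\<^sub>R \<sigma> x) \<in> borel_measurable N" for n
    by (intro borel_measurable_scaleR meas borel_measurable_integrable[OF assms(1)])
  show "(\<lambda>x. indicat_real {c<..<d} x *\<^sub>R \<sigma> x) \<in> borel_measurable N"
    by (intro borel_measurable_scaleR meas borel_measurable_integrable[OF assms(1)]) simp
  show "integrable N (\<lambda>x. norm (\<sigma> x))"
    using assms(1) by simp
  show "AE x in N. (\<lambda>n. plateau c d n x *\<^sub>R \<sigma> x) \<longlonglongrightarrow> indicat_real {c<..<d} x *\<^sub>R \<sigma> x"
    by (intro AE_I2 tendsto_scaleR plateau_tendsto_indicator tendsto_const)
  show "AE x in N. norm (plateau c d n x *\<^sub>R \<sigma> x) \<le> norm (\<sigma> x)" for n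
    using plateau_bounds[of c d n] by (auto intro!: AE_I2 mult_left_le_one_le)
qed

text \<open>Test functions approximate indicators of open intervals, so the two measures agree on open
  subintervals. These form an intersection-stable generator of the Borel subsets of the domain, and
  the class of sets on which two finite vector measures of equal total mass agree is closed under
  complements and countable disjoint unions.\<close>
lemma has_derivative_measure_unique:
  assumes \<mu>: "has_derivative_measure {a<..<b} w \<mu>" and \<nu>: "has_derivative_measure {a<..<b} w \<nu>"
    and A: "A \<in> sets borel" "A \<subseteq> {a<..<b}"
  shows "\<mu> A = \<nu> A"
proof -
  define I where "I = {a<..<b}"
  obtain N \<sigma> where N: "sets N = sets (restrict_space borel I)" "integrable N \<sigma>"
      "\<And>A. A \<in> sets N \<Longrightarrow> \<mu> A = (LINT x:A|N. \<sigma> x)"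
      "\<And>\<phi>. test_function I \<phi> \<Longrightarrow>
           (\<integral>x. deriv \<phi> x *\<^sub>R w x \<partial>lebesgue_on I) = - (\<integral>x. \<phi> x *\<^sub>R \<sigma> x \<partial>N)"
    using \<mu> unfolding has_derivative_measure_def I_def by blast
  obtain M \<tau> where M: "sets M = sets (restrict_space borel I)" "integrable M \<tau>"
      "\<And>A. A \<in> sets M \<Longrightarrow> \<nu> A = (LINT x:A|M. \<tau> x)"
      "\<And>\<phi>. test_function I \<phi> \<Longrightarrow>
           (\<integral>x. deriv \<phi> x *\<^sub>R w x \<partial>lebesgue_on I) = - (\<integral>x. \<phi> x *\<^sub>R \<tau> x \<partial>M)"
    using \<nu> unfolding has_derivative_measure_def I_def by blast
  have borel: "(borel :: real measure) = sigma UNIV (range (\<lambda>(c, d). {c<..<d}))"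
    using borel_eq_box[where 'a = real] by (simp add: box_real)
  define G where "G = (\<inter>) I ` range (\<lambda>(c, d). {c<..<d})"
  have "(\<inter>) I ` sigma_sets UNIV (range (\<lambda>(c, d). {c<..<d})) = sigma_sets I G"
    unfolding G_def
  proof (rule sigma_sets_Int)
    have "I \<in> sets borel" by (simp add: I_def)
    thus "I \<in> sigma_sets UNIV (range (\<lambda>(c, d). {c<..<d}))"
      unfolding borel by simp
  qed simp
  hence sets: "sets (restrict_space borel I) = sigma_sets I G"
    unfolding sets_restrict_space by (subst borel) simp
  have G_int: "\<exists>c d. B = {c<..<d} \<and> {c<..<d} \<subseteq> I" if B: "B \<in> G" for B
  proof -
    obtain c d where "B = I \<inter> {c<..<d}" using B unfolding G_def by (auto simp: image_iff)
    hence "B = {max a c<..<min b d}" by (auto simp: I_def)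
    thus ?thesis using \<open>B = I \<inter> {c<..<d}\<close> by blast
  qed
  have "Int_stable G"
  proof (rule Int_stableI)
    fix A B assume "A \<in> G" "B \<in> G"
    then obtain c d c' d' where "A = I \<inter> {c<..<d}" "B = I \<inter> {c'<..<d'}"
      unfolding G_def by (auto simp: image_iff)
    hence "A \<inter> B = I \<inter> {max c c'<..<min d d'}" by auto
    thus "A \<inter> B \<in> G" unfolding G_def by auto
  qed
  moreover have "G \<subseteq> Pow I" by (auto simp: G_def)
  moreover have "A \<in> sigma_sets I G"
    using A unfolding sets[symmetric] by (auto simp: sets_restrict_space_iff I_def)
  ultimately have "(LINT x:A|N. \<sigma> x) = (LINT x:A|M. \<tau> x)"
  proof (induction rule: sigma_sets_induct_disjoint)
    case (basic B)
    then obtain c d where B: "B = {c<..<d}" "{c<..<d} \<subseteq> I" using G_int by blast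
    have "(\<integral>x. plateau c d n x *\<^sub>R \<sigma> x \<partial>N) = (\<integral>x. plateau c d n x *\<^sub>R \<tau> x \<partial>M)" for n
      using N(4)[OF test_function_plateau[OF B(2)], of n] M(4)[OF test_function_plateau[OF B(2)], of n]
      by simp
    thus ?case
      unfolding B using plateau_integral_tendsto[OF N(2,1), of c d]
        plateau_integral_tendsto[OF M(2,1), of c d] by (simp add: LIMSEQ_unique)
  next
    case empty
    show ?case by (simp add: set_lebesgue_integral_def)
  next
    case (compl B)
    have "B \<subseteq> I" using compl(1) \<open>G \<subseteq> Pow I\<close> sigma_sets_into_sp by blast
    have *: "(LINT x:I - B|L. f x) = (LINT x:I|L. f x) - (LINT x:B|L. f x)"
      if "sets L = sets (restrict_space borel I)" "integrable L f"
      for L and f :: "real \<Rightarrow> real^3"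
    proof -
      have "B \<in> sets L" "I - B \<in> sets L"
        using compl(1) that sets by (auto intro: sigma_sets.Compl)
      hence "set_integrable L B f" "set_integrable L (I - B) f"
        using that(2) by (auto simp: set_integrable_def intro: integrable_mult_indicator)
      hence "(LINT x:B \<union> (I - B)|L. f x) = (LINT x:B|L. f x) + (LINT x:I - B|L. f x)"
        by (intro set_integral_Un) auto
      moreover have "B \<union> (I - B) = I" using \<open>B \<subseteq> I\<close> by auto
      ultimately show ?thesis by simp
    qed
    \<comment> \<open>The total masses agree because \<open>I\<close> is itself one of the intervals.\<close>
    have "(\<integral>x. plateau a b n x *\<^sub>R \<sigma> x \<partial>N) = (\<integral>x. plateau a b n x *\<^sub>R \<tau> x \<partial>M)" for n
      using N(4)[OF test_function_plateau, of a b n] M(4)[OF test_function_plateau, of a b n]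
      by (simp add: I_def)
    hence "(LINT x:I|N. \<sigma> x) = (LINT x:I|M. \<tau> x)"
      using plateau_integral_tendsto[OF N(2,1), of a b] plateau_integral_tendsto[OF M(2,1), of a b]
      by (simp add: I_def LIMSEQ_unique)
    with compl(2) show ?case
      using *[OF N(1,2)] *[OF M(1,2)] by simp
  next
    case (union B)
    have *: "(LINT x:(\<Union>i. B i)|L. f x) = (\<Sum>i. (LINT x:B i|L. f x))"
      if "sets L = sets (restrict_space borel I)" "integrable L f"
      for L and f :: "real \<Rightarrow> real^3"
    proof (rule lebesgue_integral_countable_add)
      show Bi: "B i \<in> sets L" for i
        using union(2) that(1) sets by auto
      show "B i \<inter> B j = {}" if "i \<noteq> j" for i j
        using union(1) that by (auto simp: disjoint_family_on_def)
      show "set_integrable L (\<Union>i. B i) f"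
        unfolding set_integrable_def using Bi that(2) by (intro integrable_mult_indicator) auto
    qed
    show ?case
      unfolding *[OF N(1,2)] *[OF M(1,2)] union(3) ..
  qed
  moreover have "A \<in> sets N" "A \<in> sets M"
    using \<open>A \<in> sigma_sets I G\<close> N(1) M(1) sets by auto
  ultimately show ?thesis using N(3) M(3) by simp
qed

section \<open>Step functions\<close>

text \<open>The value is indexed by the number of jump points that lie to the left, so that the
  finite set \<open>J\<close> of jump points need not be enumerated.\<close>
definition step_fun :: "real set \<Rightarrow> (nat \<Rightarrow> real^3) \<Rightarrow> real \<Rightarrow> real^3" where
  "step_fun J c x = c (card {t\<in>J. t < x})"

definition step_jump :: "real set \<Rightarrow> (nat \<Rightarrow> real^3) \<Rightarrow> real \<Rightarrow> real^3" where
  "step_jump J c s = c (Suc (card {t\<in>J. t < s})) - c (card {t\<in>J. t < s})"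

text \<open>A telescoping sum: the jump indices \<open>card {t\<in>A. t < s}\<close> run through \<open>0, ..., card A - 1\<close>
  as \<open>s\<close> increases through \<open>A\<close>.\<close>
lemma sum_step_jump: "finite A \<Longrightarrow> (\<Sum>s\<in>A. step_jump A c s) = c (card A) - c 0"
proof (induction rule: finite_linorder_max_induct)
  case empty
  show ?case by simp
next
  case (insert b A)
  have "{t \<in> insert b A. t < b} = A"
    using insert.hyps by auto
  moreover have "{t \<in> insert b A. t < s} = {t \<in> A. t < s}" if "s \<in> A" for s
    using insert.hyps that by (auto dest: less_asym)
  ultimately show ?case
    using insert by (auto simp: step_jump_def less_irrefl)
qed

text \<open>A superposition of Heaviside functions, which makes measurability evident and lets the
  distributional derivative be computed by linearity.\<close>
lemma step_fun_eq_sum: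
  assumes "finite J"
  shows "step_fun J c x = c 0 + (\<Sum>s\<in>J. indicator {s<..} x *\<^sub>R step_jump J c s)"
proof -
  define A where "A = {s\<in>J. s < x}"
  have "step_jump A c s = step_jump J c s" if "s \<in> A" for s
  proof -
    have "{t\<in>A. t < s} = {t\<in>J. t < s}" using that by (auto simp: A_def)
    thus ?thesis by (simp add: step_jump_def)
  qed
  moreover have "(\<Sum>s\<in>J. indicator {s<..} x *\<^sub>R step_jump J c s) = (\<Sum>s\<in>A. step_jump J c s)"
    unfolding A_def by (intro sum.mono_neutral_cong_right) (auto simp: assms indicator_def)
  moreover have "(\<Sum>s\<in>A. step_jump A c s) = c (card A) - c 0"
    using assms by (intro sum_step_jump) (simp add: A_def)
  ultimately show ?thesis
    by (simp add: step_fun_def A_def)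
qed

lemma step_fun_measurable:
  assumes "finite J"
  shows "step_fun J c \<in> borel_measurable (lebesgue_on I)"
proof -
  have "step_fun J c = (\<lambda>x. c 0 + (\<Sum>s\<in>J. indicator {s<..} x *\<^sub>R step_jump J c s))"
    by (rule ext) (rule step_fun_eq_sum[OF assms])
  moreover have "(\<lambda>x::real. c 0 + (\<Sum>s\<in>J. indicator {s<..} x *\<^sub>R step_jump J c s)) \<in> borel_measurable borel"
    by measurable
  ultimately have "step_fun J c \<in> borel_measurable lborel"
    by simp
  thus ?thesis
    by (intro measurable_restrict_space1 measurable_completion)
qed

lemma step_fun_in_fun_S2: "finite J \<Longrightarrow> range c \<subseteq> S2 \<Longrightarrow> step_fun J c \<in> fun_S2 I"
  using step_fun_measurable[of J c I] by (auto simp: fun_S2_def step_fun_def image_subset_iff)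

text \<open>The distributional derivative of a Heaviside function is a point mass. The case \<open>s = a\<close>
  covers constants, for which the right-hand side is 0.\<close>
lemma has_bochner_integral_deriv_test_function:
  assumes \<phi>: "test_function {a<..<b} \<phi>" and s: "a \<le> s" "s < b"
  shows "has_bochner_integral (lebesgue_on {a<..<b}) (\<lambda>x. indicator {s<..} x * deriv \<phi> x) (- \<phi> s)"
proof -
  obtain D where D: "\<And>x. (\<phi> has_vector_derivative D x) (at x)" and contD: "continuous_on UNIV D"
    using \<phi> by (auto simp: test_function_def C1_differentiable_on_def)
  hence [simp]: "deriv \<phi> = D"
    by (auto intro!: DERIV_imp_deriv simp: has_real_derivative_iff_has_vector_derivative)
  have D_meas: "D \<in> borel_measurable borel"
    using contD by (rule borel_measurable_continuous_onI)
  have "b \<notin> closure {x. \<phi> x \<noteq> 0}"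
    using \<phi> by (auto simp: test_function_def)
  hence "\<phi> b = 0"
    using closure_subset[of "{x. \<phi> x \<noteq> 0}"] by blast
  hence "has_bochner_integral lborel (\<lambda>x. indicator {s..b} x *\<^sub>R D x) (- \<phi> s)"
    using has_bochner_integral_FTC_Icc[of s b \<phi> D] s D contD
    by (auto intro: has_vector_derivative_at_within continuous_on_subset)
  moreover have "AE x in lborel. indicator {s..b} x *\<^sub>R D x =
      indicator {a<..<b} x *\<^sub>R (indicator {s<..} x * D x)"
    using AE_lborel_singleton[of s] AE_lborel_singleton[of b]
    by eventually_elim (use s in \<open>auto simp: indicator_def\<close>)
  ultimately have "has_bochner_integral lborel
      (\<lambda>x. indicator {a<..<b} x *\<^sub>R (indicator {s<..} x * D x)) (- \<phi> s)"
    using D_meas by (subst (asm) has_bochner_integral_cong_AE) (auto simp: borel_measurable_indicator)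
  hence "has_bochner_integral lebesgue
      (\<lambda>x. indicator {a<..<b} x *\<^sub>R (indicator {s<..} x * D x)) (- \<phi> s)"
    by (auto simp: has_bochner_integral_iff integrable_completion integral_completion
             dest: borel_measurable_integrable)
  thus ?thesis
    by (auto simp: has_bochner_integral_iff integrable_restrict_space integral_restrict_space)
qed

lemma has_derivative_measure_step_fun:
  assumes J: "finite J" "J \<subseteq> {a<..<b}" and "a < b"
  shows "has_derivative_measure {a<..<b} (step_fun J c) (\<lambda>A. \<Sum>s\<in>J \<inter> A. step_jump J c s)"
proof -
  define I where "I = {a<..<b}"
  \<comment> \<open>Counting measure on \<open>J\<close>, seen as a measure on \<open>I\<close>, with the jumps as density. The density is
    written as a sum of indicators to have it Borel measurable on the whole line.\<close>
  define N where "N = distr (count_space J) (restrict_space borel I) (\<lambda>x. x)"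
  define \<sigma> where "\<sigma> x = (\<Sum>s\<in>J. indicator {s} x *\<^sub>R step_jump J c s)" for x
  have id: "(\<lambda>x. x) \<in> count_space J \<rightarrow>\<^sub>M restrict_space borel I"
    using J by (auto simp: I_def space_restrict_space)
  have N: "sets N = sets (restrict_space borel I)"
    by (simp add: N_def)
  have meas: "f \<in> borel_measurable (restrict_space borel I)" if "f \<in> borel_measurable borel"
    for f :: "real \<Rightarrow> 'c :: topological_space"
    using that by (rule measurable_restrict_space1)
  have \<sigma>_meas: "\<sigma> \<in> borel_measurable borel"
    unfolding \<sigma>_def by measurable
  have \<sigma>_J: "\<sigma> s = step_jump J c s" if "s \<in> J" for s
  proof -
    have "\<sigma> s = (\<Sum>t\<in>J. if s = t then step_jump J c t else 0)"
      unfolding \<sigma>_def by (intro sum.cong) auto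
    thus ?thesis using that J(1) by simp
  qed
  have int_N: "(\<integral>x. f x *\<^sub>R \<sigma> x \<partial>N) = (\<Sum>s\<in>J. f s *\<^sub>R step_jump J c s)"
    if "f \<in> borel_measurable borel" for f
  proof -
    have "(\<lambda>x. f x *\<^sub>R \<sigma> x) \<in> borel_measurable borel"
      using that \<sigma>_meas by measurable
    hence "(\<integral>x. f x *\<^sub>R \<sigma> x \<partial>N) = (\<integral>x. f x *\<^sub>R \<sigma> x \<partial>count_space J)"
      unfolding N_def by (intro integral_distr id meas)
    thus ?thesis
      using J by (simp add: lebesgue_integral_count_space_finite \<sigma>_J)
  qed
  have fin: "finite_measure N"
    unfolding N_def using J by (intro finite_measure.finite_measure_distr id finite_measure_count_space)
  have int: "integrable N \<sigma>"
    unfolding N_def using J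
    by (subst integrable_distr_eq[OF id meas[OF \<sigma>_meas]]) (simp add: integrable_count_space)
  have "(\<Sum>s\<in>J \<inter> A. step_jump J c s) = (LINT x:A|N. \<sigma> x)" if "A \<in> sets N" for A
  proof -
    have "A \<in> sets borel"
      using that by (auto simp: N sets_restrict_space I_def)
    hence "(LINT x:A|N. \<sigma> x) = (\<Sum>s\<in>J. indicator A s *\<^sub>R step_jump J c s)"
      unfolding set_lebesgue_integral_def by (intro int_N) simp
    also have "\<dots> = (\<Sum>s\<in>J \<inter> A. step_jump J c s)"
      using J by (intro sum.mono_neutral_cong_right) (auto simp: indicator_def)
    finally show ?thesis by simp
  qed
  moreover have "(\<integral>x. deriv \<phi> x *\<^sub>R step_fun J c x \<partial>lebesgue_on I) = - (\<integral>x. \<phi> x *\<^sub>R \<sigma> x \<partial>N)"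
    if \<phi>: "test_function I \<phi>" for \<phi>
  proof -
    note half_line = has_bochner_integral_deriv_test_function[OF \<phi>[unfolded I_def], folded I_def]
    have "a \<notin> closure {x. \<phi> x \<noteq> 0}"
      using \<phi> by (auto simp: test_function_def I_def)
    hence "\<phi> a = 0"
      using closure_subset[of "{x. \<phi> x \<noteq> 0}"] by blast
    have "has_bochner_integral (lebesgue_on I)
        (\<lambda>x. (indicator {a<..} x * deriv \<phi> x) *\<^sub>R c 0 +
             (\<Sum>s\<in>J. (indicator {s<..} x * deriv \<phi> x) *\<^sub>R step_jump J c s))
        ((- \<phi> a) *\<^sub>R c 0 + (\<Sum>s\<in>J. (- \<phi> s) *\<^sub>R step_jump J c s))"
      using J \<open>a < b\<close>
      by (intro has_bochner_integral_add has_bochner_integral_sum has_bochner_integral_scaleR_left half_line)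
         auto
    hence "(\<integral>x. (indicator {a<..} x * deriv \<phi> x) *\<^sub>R c 0 +
             (\<Sum>s\<in>J. (indicator {s<..} x * deriv \<phi> x) *\<^sub>R step_jump J c s) \<partial>lebesgue_on I)
          = - (\<Sum>s\<in>J. \<phi> s *\<^sub>R step_jump J c s)"
      using \<open>\<phi> a = 0\<close> by (simp add: has_bochner_integral_iff sum_negf)
    moreover have "(\<integral>x. deriv \<phi> x *\<^sub>R step_fun J c x \<partial>lebesgue_on I) =
        (\<integral>x. (indicator {a<..} x * deriv \<phi> x) *\<^sub>R c 0 +
             (\<Sum>s\<in>J. (indicator {s<..} x * deriv \<phi> x) *\<^sub>R step_jump J c s) \<partial>lebesgue_on I)"
      by (intro Bochner_Integration.integral_cong refl)
         (auto simp: I_def step_fun_eq_sum[OF J(1)] scaleR_add_right scaleR_sum_right mult.commute)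
    moreover have "\<phi> \<in> borel_measurable borel"
      using \<phi> by (auto simp: test_function_def intro!: borel_measurable_continuous_onI C1_differentiable_imp_continuous_on)
    ultimately show ?thesis
      by (simp add: int_N)
  qed
  ultimately show ?thesis
    unfolding has_derivative_measure_def I_def[symmetric] using fin N int by blast
qed

text \<open>No interval is a null set, so a filter all of whose members contain intervals is compatible
  with discarding null sets. This makes the essential one-sided limits well defined.\<close>
lemma inf_ae_filter_nontrivial:
  assumes "\<And>P. eventually P F \<Longrightarrow> \<exists>y z. y < z \<and> (\<forall>x\<in>{y<..<z}. P x)"
  shows "inf F (ae_filter (lebesgue :: real measure)) \<noteq> bot"
proof
  assume "inf F (ae_filter (lebesgue :: real measure)) = bot"
  hence "eventually (\<lambda>_. False) (inf F (ae_filter (lebesgue :: real measure)))"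
    by simp
  then obtain P Q where P: "eventually P F" and Q: "AE x in (lebesgue :: real measure). Q x"
      and PQ: "\<And>x. P x \<Longrightarrow> Q x \<Longrightarrow> False"
    unfolding eventually_inf by blast
  obtain y z where "y < z" "\<forall>x\<in>{y<..<z}. P x"
    using assms[OF P] by blast
  with PQ have "x \<notin> {y<..<z}" if "Q x" for x
    using that by blast
  hence "AE x in lebesgue. x \<notin> {y<..<z}"
    using Q by (elim eventually_mono)
  hence "{y<..<z} \<in> null_sets lebesgue"
    by (subst AE_iff_null_sets) auto
  thus False
    using \<open>y < z\<close> by (simp add: null_sets_def)
qed

lemma one_sided_ae_filters_nontrivial:
  fixes x :: real
  shows "inf (at_left x) (ae_filter lebesgue) \<noteq> bot" "inf (at_right x) (ae_filter lebesgue) \<noteq> bot"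
proof -
  obtain l r where "l < x" "x < r"
    using lt_ex gt_ex by metis
  show "inf (at_left x) (ae_filter lebesgue) \<noteq> bot"
  proof (rule inf_ae_filter_nontrivial)
    fix P assume "eventually P (at_left x)"
    then obtain y where "y < x" "\<forall>t>y. t < x \<longrightarrow> P t"
      unfolding eventually_at_left[OF \<open>l < x\<close>] by blast
    thus "\<exists>y z. y < z \<and> (\<forall>t\<in>{y<..<z}. P t)"
      by (intro exI[of _ y] exI[of _ x]) simp
  qed
  show "inf (at_right x) (ae_filter lebesgue) \<noteq> bot"
  proof (rule inf_ae_filter_nontrivial)
    fix P assume "eventually P (at_right x)"
    then obtain y where "x < y" "\<forall>t>x. t < y \<longrightarrow> P t"
      unfolding eventually_at_right[OF \<open>x < r\<close>] by blast
    thus "\<exists>y z. y < z \<and> (\<forall>t\<in>{y<..<z}. P t)"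
      by (intro exI[of _ x] exI[of _ y]) simp
  qed
qed

lemma step_fun_one_sided_limits:
  assumes "finite J"
  shows "left_lim (step_fun J c) x = c (card {t\<in>J. t < x})"
    and "right_lim (step_fun J c) x = c (card {t\<in>J. t \<le> x})"
proof -
  have "\<forall>\<^sub>F y in at_left x. \<forall>t\<in>{t\<in>J. t < x}. t < y"
    using assms by (intro eventually_ball_finite) (auto intro: eventually_at_leftI[of _ x])
  moreover have "\<forall>\<^sub>F y in at_left x. y < x"
    by (simp add: eventually_at_filter)
  ultimately have "\<forall>\<^sub>F y in at_left x. step_fun J c y = c (card {t\<in>J. t < x})"
  proof eventually_elim
    case (elim y)
    hence "{t\<in>J. t < y} = {t\<in>J. t < x}" by auto
    thus ?case by (simp add: step_fun_def)
  qed
  hence "(step_fun J c \<longlongrightarrow> c (card {t\<in>J. t < x})) (inf (at_left x) (ae_filter lebesgue))"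
    by (intro tendsto_eventually) (rule filter_leD[OF inf_le1])
  thus "left_lim (step_fun J c) x = c (card {t\<in>J. t < x})"
    unfolding left_lim_def by (intro tendsto_Lim one_sided_ae_filters_nontrivial)
  have "\<forall>\<^sub>F y in at_right x. \<forall>t\<in>{t\<in>J. x < t}. y < t"
    using assms by (intro eventually_ball_finite) (auto intro: eventually_at_rightI[of x])
  moreover have "\<forall>\<^sub>F y in at_right x. x < y"
    by (simp add: eventually_at_filter)
  ultimately have "\<forall>\<^sub>F y in at_right x. step_fun J c y = c (card {t\<in>J. t \<le> x})"
  proof eventually_elim
    case (elim y)
    hence "t < y \<longleftrightarrow> t \<le> x" if "t \<in> J" for t
      using that by (cases "x < t") (auto dest: less_asym)
    hence "{t\<in>J. t < y} = {t\<in>J. t \<le> x}" by auto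
    thus ?case by (simp add: step_fun_def)
  qed
  hence "(step_fun J c \<longlongrightarrow> c (card {t\<in>J. t \<le> x})) (inf (at_right x) (ae_filter lebesgue))"
    by (intro tendsto_eventually) (rule filter_leD[OF inf_le1])
  thus "right_lim (step_fun J c) x = c (card {t\<in>J. t \<le> x})"
    unfolding right_lim_def by (intro tendsto_Lim one_sided_ae_filters_nontrivial)
qed

text \<open>The derivative measure is a sum of point masses, and the diffuse part discards exactly the
  points that carry mass.\<close>
lemma total_variation_diffuse_part_step_fun:
  assumes J: "finite J" "J \<subseteq> {a<..<b}" and "a < b"
  shows "total_variation (diffuse_part (derivative_measure {a<..<b} (step_fun J c))) {a<..<b} = 0"
proof -
  define \<mu> where "\<mu> = derivative_measure {a<..<b} (step_fun J c)"
  have ex: "has_derivative_measure {a<..<b} (step_fun J c) (\<lambda>A. \<Sum>s\<in>J \<inter> A. step_jump J c s)"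
    by (rule has_derivative_measure_step_fun[OF assms])
  hence "has_derivative_measure {a<..<b} (step_fun J c) \<mu>"
    unfolding \<mu>_def derivative_measure_def by (rule someI[of "has_derivative_measure _ _"])
  note \<mu> = has_derivative_measure_unique[OF this ex]
  have zero: "diffuse_part \<mu> A = 0" if A: "A \<in> sets borel" "A \<subseteq> {a<..<b}" for A
  proof -
    define T where "T = {x\<in>A. \<mu> {x} \<noteq> 0}"
    have T: "x \<in> T \<longleftrightarrow> x \<in> A \<and> x \<in> J \<and> step_jump J c x \<noteq> 0" for x
    proof (cases "x \<in> A")
      case True
      hence "\<mu> {x} = (\<Sum>s\<in>J \<inter> {x}. step_jump J c s)"
        using A by (intro \<mu>) auto
      thus ?thesis using True by (cases "x \<in> J") (auto simp: T_def)
    qed (simp add: T_def)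
    hence "T \<subseteq> J" by auto
    hence "T \<in> sets borel"
      using J(1) by (intro finite_imp_closed[THEN borel_closed]) (rule finite_subset)
    hence "\<mu> (A - T) = (\<Sum>s\<in>J \<inter> (A - T). step_jump J c s)"
      using A by (intro \<mu>) auto
    also have "\<dots> = 0"
      by (intro sum.neutral) (auto simp: T)
    finally show ?thesis
      by (simp add: diffuse_part_def T_def)
  qed
  have "total_variation (diffuse_part \<mu>) {a<..<b} \<le> 0"
    unfolding total_variation_def
  proof (rule SUP_least)
    fix E :: "nat \<Rightarrow> real set"
    assume "E \<in> {E. range E \<subseteq> sets borel \<and> disjoint_family E \<and> (\<Union>n. E n) = {a<..<b}}"
    hence "E n \<in> sets borel" "E n \<subseteq> {a<..<b}" for n
      by auto
    thus "(\<Sum>n. ennreal (norm (diffuse_part \<mu> (E n)))) \<le> 0"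
      by (simp add: zero)
  qed
  thus ?thesis
    by (simp add: \<mu>_def)
qed

lemma variation_S2_step_fun:
  assumes J: "finite J" "J \<subseteq> {a<..<b}" and "a < b" and c: "range c \<subseteq> S2"
  shows "variation_S2 {a<..<b} (step_fun J c) {a<..<b} =
           (\<Sum>s\<in>J. ennreal (dist_S2 (c (card {t\<in>J. t < s})) (c (Suc (card {t\<in>J. t < s})))))"
proof -
  let ?k = "\<lambda>s. card {t\<in>J. t < s}"
  have right: "card {t\<in>J. t \<le> s} = (if s \<in> J then Suc (?k s) else ?k s)" for s
  proof (cases "s \<in> J")
    case True
    hence "{t\<in>J. t \<le> s} = insert s {t\<in>J. t < s}" by auto
    thus ?thesis using True J(1) by simp
  next
    case False
    hence "{t\<in>J. t \<le> s} = {t\<in>J. t < s}" by (auto simp: le_less)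
    thus ?thesis using False by simp
  qed
  note lims = step_fun_one_sided_limits[OF J(1), of c]
  have jumps: "{a<..<b} \<inter> jump_set {a<..<b} (step_fun J c) = {s\<in>J. c (?k s) \<noteq> c (Suc (?k s))}"
    using J(2) by (auto simp: jump_set_def lims right split: if_splits)
  have "(\<Sum>\<^sub>\<infinity>x\<in>{a<..<b} \<inter> jump_set {a<..<b} (step_fun J c).
           ennreal (dist_S2 (left_lim (step_fun J c) x) (right_lim (step_fun J c) x)))
      = (\<Sum>s\<in>{s\<in>J. c (?k s) \<noteq> c (Suc (?k s))}. ennreal (dist_S2 (c (?k s)) (c (Suc (?k s)))))"
    unfolding jumps using J(1) by (simp add: lims right)
  also have "\<dots> = (\<Sum>s\<in>J. ennreal (dist_S2 (c (?k s)) (c (Suc (?k s)))))"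
    using J(1) c by (intro sum.mono_neutral_left) (auto simp: dist_S2_self image_subset_iff)
  finally show ?thesis
    unfolding variation_S2_def total_variation_diffuse_part_step_fun[OF assms(1-3)] by simp
qed

section \<open>Lack of semiconvexity\<close>

abbreviation oscillation :: "real set \<Rightarrow> real^3 \<Rightarrow> real^3 \<Rightarrow> real \<Rightarrow> real^3" where
  "oscillation J p q \<equiv> step_fun J (\<lambda>k. if even k then p else q)"

lemma variation_S2_oscillation:
  assumes J: "finite J" "J \<subseteq> {a<..<b}" and "a < b" and pq: "p \<in> S2" "q \<in> S2"
  shows "enn2ereal (variation_S2 {a<..<b} (oscillation J p q) {a<..<b}) = ereal (card J * dist_S2 p q)"
proof -
  have "variation_S2 {a<..<b} (oscillation J p q) {a<..<b} = (\<Sum>s\<in>J. ennreal (dist_S2 p q))"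
  proof (subst variation_S2_step_fun[OF assms(1-3)])
    show "range (\<lambda>k::nat. if even k then p else q) \<subseteq> S2"
      using pq by auto
  qed (intro sum.cong refl, simp add: dist_S2_commute[of q p])
  also have "\<dots> = ennreal (card J * dist_S2 p q)"
    using dist_S2_bounds(2)[OF pq] by (simp add: ennreal_mult ennreal_of_nat_eq_real_of_nat)
  finally show ?thesis
    using dist_S2_bounds(2)[OF pq] by (simp add: enn2ereal_ennreal)
qed

lemma oscillation_in_fun_S2:
  "finite J \<Longrightarrow> p \<in> S2 \<Longrightarrow> q \<in> S2 \<Longrightarrow> oscillation J p q \<in> fun_S2 I"
  by (rule step_fun_in_fun_S2) auto

lemma oscillation_in_BV_S2:
  assumes J: "finite J" "J \<subseteq> {a<..<b}" and "a < b" and pq: "p \<in> S2" "q \<in> S2"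
  shows "oscillation J p q \<in> BV_S2 {a<..<b}"
proof -
  have in_fun: "oscillation J p q \<in> fun_S2 {a<..<b}"
    by (rule oscillation_in_fun_S2[OF J(1) pq])
  have "finite_measure (lebesgue_on {a<..<b})"
    by (intro finite_measure_lebesgue_on) simp
  hence "integrable (lebesgue_on {a<..<b}) (oscillation J p q)"
    using in_fun by (intro finite_measure.integrable_const_bound[where B = 1]) (auto simp: fun_S2_def)
  thus ?thesis
    using in_fun has_derivative_measure_step_fun[OF assms(1-3)]
    by (auto simp: BV_S2_def BV_def fun_S2_def)
qed

theorem proposition3p1:
  fixes a b r :: real
  assumes "a < b" and "r > 0"
  shows "\<not> geodesically_semiconvex (L2_S2 {a<..<b}) (dist_L2 {a<..<b})
             (TV_functional {a<..<b} r)"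
proof
  define I where "I = {a<..<b}"
  assume "geodesically_semiconvex (L2_S2 {a<..<b}) (dist_L2 {a<..<b}) (TV_functional {a<..<b} r)"
  then obtain \<kappa> where convex: "geodesically_convex (L2_S2 I) (dist_L2 I) \<kappa> (TV_functional I r)"
    unfolding geodesically_semiconvex_def I_def by blast
  have I: "open I"
    by (simp add: I_def)
  have fin: "finite_measure (lebesgue_on I)"
    unfolding I_def by (intro finite_measure_lebesgue_on) simp
  \<comment> \<open>A rectangle with \<open>2 * \<phi> < r\<close> lies in the ball, so that the functional is finite at the two end
    points of the geodesic.\<close>
  define \<phi> where "\<phi> = min r 1 / 3"
  have \<phi>: "0 < \<phi>" "\<phi> < pi / 4" "2 * \<phi> < r"
    using \<open>r > 0\<close> pi_gt3 by (auto simp: \<phi>_def min_def)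
  obtain p p' q q' m m' :: "real^3" where
    S: "{p, p', q, q', m, m'} \<subseteq> S2"
    and near: "\<And>x. x \<in> {p, p', q, q'} \<Longrightarrow> dist_S2 e1 x \<le> 2 * \<phi>"
    and mid: "p + p' = (2 * cos \<phi>) *\<^sub>R m" "q + q' = (2 * cos \<phi>) *\<^sub>R m'"
    and side: "dist_S2 p p' = 2 * \<phi>" "dist_S2 q q' = 2 * \<phi>"
    and less: "dist_S2 p q < dist_S2 m m'" "dist_S2 p' q' < dist_S2 m m'"
    using spherical_rectangle[OF \<phi>(1,2)] by metis
  have ball: "x \<in> closure (ball_S2 e1 r)" if "x \<in> {p, p', q, q'}" for x
    using near[OF that] S that \<phi>(3) closure_subset[of "ball_S2 e1 r"]
    by (force simp: ball_S2_def)
  have "cos \<phi> > 0"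
    using \<phi> by (intro cos_gt_zero) auto
  \<comment> \<open>The squared distance of the two oscillations below, which does not depend on the number of
    jumps.\<close>
  define D where "D = (2 * \<phi>)\<^sup>2 * measure (lebesgue_on I) (space (lebesgue_on I))"
  have bound: "n * (2 * dist_S2 m m' - dist_S2 p q - dist_S2 p' q') \<le> - (\<kappa> * D / 4)" for n :: nat
  proof -
    have "infinite I"
      using \<open>a < b\<close> by (simp add: I_def infinite_Ioo)
    then obtain J where J: "finite J" "card J = n" "J \<subseteq> I"
      by (rule infinite_arbitrarily_large[THEN exE]) auto
    define u where "u = oscillation J p q"
    define v where "v = oscillation J p' q'"
    have uv: "u \<in> fun_S2 I" "v \<in> fun_S2 I"
      unfolding u_def v_def using J(1) S by (auto intro!: oscillation_in_fun_S2)
    have classes: "L2_class I u \<in> L2_S2 I" "L2_class I v \<in> L2_S2 I"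
      using uv by (auto simp: L2_S2_def intro!: quotientI)
    have TV_uv: "TV_functional I r (L2_class I u) = ereal (n * dist_S2 p q)"
                "TV_functional I r (L2_class I v) = ereal (n * dist_S2 p' q')"
    proof -
      have *: "TV_functional I r (L2_class I (oscillation J x y)) = ereal (n * dist_S2 x y)"
        if "{x, y} \<subseteq> {p, p', q, q'}" for x y
      proof -
        have xy: "x \<in> S2" "y \<in> S2" using S that by auto
        have "oscillation J x y t \<in> closure (ball_S2 e1 r)" for t
          using ball that by (simp add: step_fun_def)
        thus ?thesis
          using variation_S2_oscillation[OF J(1) J(3)[unfolded I_def] \<open>a < b\<close> xy]
            oscillation_in_BV_S2[OF J(1) J(3)[unfolded I_def] \<open>a < b\<close> xy] J(2)
          unfolding TV_functional_class[OF I oscillation_in_fun_S2[OF J(1) xy]]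
          by (simp add: I_def)
      qed
      show "TV_functional I r (L2_class I u) = ereal (n * dist_S2 p q)"
           "TV_functional I r (L2_class I v) = ereal (n * dist_S2 p' q')"
        unfolding u_def v_def by (intro *; simp)+
    qed
    have dist_uv: "dist_S2 (u x) (v x) = 2 * \<phi>" for x
      by (simp add: u_def v_def step_fun_def side)
    hence d: "(dist_L2 I (L2_class I u) (L2_class I v))\<^sup>2 = D"
      by (simp add: dist_L2_class uv D_def mult.commute)
    obtain \<gamma> where \<gamma>: "const_speed_geodesic (L2_S2 I) (dist_L2 I) \<gamma>"
        "\<gamma> 0 = L2_class I u" "\<gamma> 1 = L2_class I v"
      and ineq: "\<And>t. t \<in> {0..1} \<Longrightarrow> TV_functional I r (\<gamma> t) \<le>
          ereal (1 - t) * TV_functional I r (L2_class I u) + ereal t * TV_functional I r (L2_class I v)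
            - ereal (1/2 * \<kappa> * t * (1 - t) * (dist_L2 I (L2_class I u) (L2_class I v))\<^sup>2)"
      using convex classes unfolding geodesically_convex_def by meson
    have "\<gamma> (1/2) \<in> L2_S2 I"
      using \<gamma>(1) by (simp add: const_speed_geodesic_def)
    then obtain w where w: "w \<in> fun_S2 I" "\<gamma> (1/2) = L2_class I w"
      unfolding L2_S2_def by (rule quotientE)
    have "dist_L2 I (\<gamma> 0) (\<gamma> (1/2)) = dist_L2 I (\<gamma> 0) (\<gamma> 1) / 2"
         "dist_L2 I (\<gamma> (1/2)) (\<gamma> 1) = dist_L2 I (\<gamma> 0) (\<gamma> 1) / 2"
    proof -
      have "dist_L2 I (\<gamma> s) (\<gamma> t) = \<bar>t - s\<bar> * dist_L2 I (\<gamma> 0) (\<gamma> 1)"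
        if "s \<in> {0..1}" "t \<in> {0..1}" for s t
        using \<gamma>(1) that unfolding const_speed_geodesic_def by blast
      from this[of 0 "1/2"] this[of "1/2" 1]
      show "dist_L2 I (\<gamma> 0) (\<gamma> (1/2)) = dist_L2 I (\<gamma> 0) (\<gamma> 1) / 2"
           "dist_L2 I (\<gamma> (1/2)) (\<gamma> 1) = dist_L2 I (\<gamma> 0) (\<gamma> 1) / 2"
        by simp_all
    qed
    hence "AE x in lebesgue_on I. dist_S2 (u x) (w x) = \<phi> \<and> dist_S2 (w x) (v x) = \<phi>"
      using L2_midpoint_pointwise[OF fin uv w(1)] by (simp add: \<gamma> w(2) dist_uv)
    moreover have "AE x in lebesgue_on I. w x \<in> S2"
      using w(1) by (simp add: fun_S2_def)
    ultimately have w_eq: "AE x in lebesgue_on I. w x = oscillation J m m' x"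
    proof eventually_elim
      case (elim x)
      show ?case
      proof (cases "even (card {t\<in>J. t < x})")
        case True
        with elim have "w x = m"
          using S \<open>cos \<phi> > 0\<close>
          by (intro S2_midpoint_unique[OF _ _ _ _ mid(1)]) (auto simp: u_def v_def step_fun_def)
        with True show ?thesis by (simp add: step_fun_def)
      next
        case False
        with elim have "w x = m'"
          using S \<open>cos \<phi> > 0\<close>
          by (intro S2_midpoint_unique[OF _ _ _ _ mid(2)]) (auto simp: u_def v_def step_fun_def)
        with False show ?thesis by (simp add: step_fun_def)
      qed
    qed
    have "variation_S2 I w I = variation_S2 I (oscillation J m m') I"
      using w(1) w_eq by (intro variation_S2_cong_AE I order.refl step_fun_measurable J(1))
        (auto simp: fun_S2_def)
    \<comment> \<open>Only a lower bound: should the midpoint leave the ball, the functional is infinite there.\<close>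
    hence "ereal (n * dist_S2 m m') \<le> TV_functional I r (\<gamma> (1/2))"
      unfolding w(2) TV_functional_class[OF I w(1)]
      using variation_S2_oscillation[OF J(1) J(3)[unfolded I_def] \<open>a < b\<close>, of m m'] S J(2)
      by (simp add: I_def)
    also have "\<dots> \<le> ereal (n * dist_S2 p q / 2 + n * dist_S2 p' q' / 2 - \<kappa> * D / 8)"
      using ineq[of "1/2"] by (simp add: TV_uv d)
    finally show ?thesis
      by (simp add: algebra_simps)
  qed
  obtain n :: nat where "- (\<kappa> * D / 4) < n * (2 * dist_S2 m m' - dist_S2 p q - dist_S2 p' q')"
    using less reals_Archimedean3[of "2 * dist_S2 m m' - dist_S2 p q - dist_S2 p' q'"] by auto
  with bound[of n] show False by simp
qed

end
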